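(* For every $n\in\mathbb{N}$, there exists a unique $T_n$-tiling $f\colon\mathbb{N}\times\mathbb{N}\to T_n$ such that $f(0,0)=t_0$. Moreover, if $C_0,C_1,C_2,\ldots$ is the computation of $M_0$ on the input $\overline{n}$, then for every $m\in\mathbb{N}$ $$C_m=\mathrm{up}(f(0,m))\ \mathrm{up}(f(1,m))\ \mathrm{up}(f(2,m))\ \ldots$$ (concatenation of words).
   Context: Turing machines. A Turing machine is $M=\langle\Sigma,Q,q_0,F,\delta\rangle$ with $\Sigma$ a finite alphabet containing $\Box$ (blank) and $\#$ (end tape marker), $Q$ a finite set of states disjoint from $\Sigma$, $q_0\in Q$ initial, $F\subseteq Q$ the halting states, and a program $\delta\colon Q\times\Sigma\to Q\times\Sigma\times\{L,S,R\}$ such that, whenever $\delta(q,s)=(q',s',\Delta)$: $q'\ne q_0$; $s=\#$ iff $s'=\#$; $\Delta\neq L$ if $s=\#$; and $q'=q$, $s'=s$, $\Delta=S$ if $q\in F$. A configuration is an $\omega$-word $vqv'$ with $q\in Q$ and $vv'=a_0a_1a_2\ldots$ an $\omega$-word over $\Sigma$ that is eventually $\Box$ and with $a_i=\#$ iff $i=0$; the machine is in state $q$ scanning the first symbol of $v'$. Applying $\delta(q,s)=(q',s',\Delta)$ when in state $q$ scanning $s$: the state becomes $q'$, $s$ is replaced by $s'$, and the head moves one cell left, stays, or moves one cell right according to $\Delta=L,S,R$. The computation on input word $x$ over $\Sigma\setminus\{\Box,\#\}$ is the infinite sequence of configurations $C_0=q_0\#x\Box\Box\ldots$, $C_{m+1}$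 obtained from $C_m$ by applying $\delta$ (halting configurations are repeated forever). For $m\in\mathbb{N}$, $\overline{m}$ is the word consisting of $m$ copies of the symbol $|$ ($\overline{0}$ is the empty word). The machine $M_0$. Fix disjoint recursively enumerable, recursively inseparable sets $\mathbb{X},\mathbb{Y}\subseteq\mathbb{N}$, and let $M_0=\langle\Sigma_0,Q_0,q_0,F_0,\delta_0\rangle$ be a fixed Turing machine with $|\in\Sigma_0\setminus\{\Box,\#\}$ and with two halting states $q_{\mathbb{X}},q_{\mathbb{Y}}$ such that on input $\overline m$ it halts in $q_{\mathbb X}$ if $m\in\mathbb{X}$, halts in $q_{\mathbb Y}$ if $m\in\mathbb{Y}$, and does not halt if $m\notin\mathbb{X}\cup\mathbb{Y}$; when it halts the scanned cell is the leftmost one (containing $\#$). Tiles. A tile type $t$ is given by four words $\mathrm{left}(t),\mathrm{right}(t),\mathrm{up}(t),\mathrm{down}(t)$; below we write $t=(\mathrm{left},\mathrm{right},\mathrm{up},\mathrm{down})$. For a set $T$ of tile types, a $T$-tiling is a function $f\colon\mathbb{N}\times\mathbb{N}\to T$ with $\mathrm{right}(f(i,j))=\mathrm{left}(f(i+1,j))$ and $\mathrm{up}(f(i,j))=\mathrm{down}(f(i,j+1))$ for all $i,j$. Let $\otimes$ and $*$ be new symbols not in $\Sigma_0\cup Q_0$; $**$ is the two-letter word. The finite set $T_{M_0}$ consists of the following tile types: - $t_0=(\otimes,\overline{0},q_0\#,\otimes)$; - $t^*_s=( *,*,s,s)$ for $s\in\Sigma_0\setminus\{\#\}$, and $t^*_\#=(\otimes,*,\#,\#)$;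 - for each $(q,s)$ with $\delta_0(q,s)=(q',s',S)$: $t_{qs}=( *,*,q's',qs)$ if $s\ne\#$, and $t_{q\#}=(\otimes,*,q'\#,q\#)$ if $s=\#$; - for each $(q,s)$ with $\delta_0(q,s)=(q',s',R)$: $t_{qs}=( *,qs,s',qs)$ if $s\neq\#$, and $t_{q\#}=(\otimes,q\#,\#,q\#)$ if $s=\#$; and $t_{qs}^a=(qs,*,q'a,a)$ for every $a\in\Sigma_0\setminus\{\#\}$; - for each $(q,s)$ with $\delta_0(q,s)=(q',s',L)$: $t_{qs}=(qs,*,s',qs)$; $t^a_{qs}=( *,qs,q'a,a)$ for every $a\in\Sigma_0\setminus\{\#\}$; and $t^\#_{qs}=(\otimes,qs,q'\#,\#)$. Further let $t^{**}_\Box=( **,**,\Box,\otimes)$ and, for $k\in\mathbb{N}$, $t^\otimes_k=(\overline{k},\overline{k+1},|,\otimes)$ and $t^{**}_k=(\overline{k},**,\Box,\otimes)$. Finally, $T_n=T_{M_0}\cup\{t^\otimes_k:k<n\}\cup\{t^{**}_n\}\cup\{t^{**}_\Box\}$. *)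

theory Defs
  imports Main "HOL-Library.Stream"
begin

section \<open>Turing machines\<close>

text \<open>
  \<open>Blank\<close> is the blank symbol, \<open>Hash\<close> the end tape marker, and \<open>Bar\<close> the symbol used to
  write natural numbers in unary; \<open>Other\<close> provides all remaining tape symbols.
\<close>

datatype 's sym = Blank | Hash | Bar | Other 's

datatype move = MoveL | MoveS | MoveR

text \<open>
  The program is a total function of the logic; only its values on \<open>states M \<times> alphabet M\<close>
  are constrained or used.  States and tape symbols have different types, so the two sets
  are automatically disjoint.
\<close>

record ('q, 's) tm =
  alphabet :: "'s sym set"
  states :: "'q set"
  init :: 'q
  halting :: "'q set"
  prog :: "'q \<Rightarrow> 's sym \<Rightarrow> 'q \<times> 's sym \<times> move"

definition turing_machine :: "('q, 's) tm \<Rightarrow> bool" where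
  "turing_machine M \<longleftrightarrow>
     finite (alphabet M) \<and> Blank \<in> alphabet M \<and> Hash \<in> alphabet M \<and>
     finite (states M) \<and> init M \<in> states M \<and> halting M \<subseteq> states M \<and>
     (\<forall>q \<in> states M. \<forall>s \<in> alphabet M. \<forall>q' s' d. prog M q s = (q', s', d) \<longrightarrow>
        q' \<in> states M \<and> s' \<in> alphabet M \<and>
        q' \<noteq> init M \<and>
        (s = Hash \<longleftrightarrow> s' = Hash) \<and>
        (s = Hash \<longrightarrow> d \<noteq> MoveL) \<and>
        (q \<in> halting M \<longrightarrow> q' = q \<and> s' = s \<and> d = MoveS))"

text \<open>
  The triple \<open>(v, q, v')\<close> stands for the infinite word \<open>v q v'\<close>: the tape content is
  \<open>v @- v'\<close>, the state is \<open>q\<close>, and the head scans the first symbol of \<open>v'\<close>.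
\<close>

type_synonym ('q, 's) config = "'s sym list \<times> 'q \<times> 's sym stream"

definition configuration :: "('q, 's) tm \<Rightarrow> ('q, 's) config \<Rightarrow> bool" where
  "configuration M = (\<lambda>(v, q, v').
     q \<in> states M \<and> sset (v @- v') \<subseteq> alphabet M \<and>
     (\<exists>N. \<forall>i\<ge>N. (v @- v') !! i = Blank) \<and>
     (\<forall>i. (v @- v') !! i = Hash \<longleftrightarrow> i = 0))"

definition config_state :: "('q, 's) config \<Rightarrow> 'q" where
  "config_state = (\<lambda>(v, q, v'). q)"

definition scans_leftmost :: "('q, 's) config \<Rightarrow> bool" where
  "scans_leftmost = (\<lambda>(v, q, v'). v = [])"

text \<open>
  In the \<open>MoveL\<close> case \<open>v\<close> is nonempty for every configuration of a Turing machine, because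
  the leftmost cell is the one containing \<open>Hash\<close>.
\<close>

definition step :: "('q, 's) tm \<Rightarrow> ('q, 's) config \<Rightarrow> ('q, 's) config" where
  "step M = (\<lambda>(v, q, v').
     case prog M q (shd v') of
       (q', s', MoveL) \<Rightarrow> (butlast v, q', last v ## s' ## stl v')
     | (q', s', MoveS) \<Rightarrow> (v, q', s' ## stl v')
     | (q', s', MoveR) \<Rightarrow> (v @ [s'], q', stl v'))"

primrec computation :: "('q, 's) tm \<Rightarrow> 's sym list \<Rightarrow> nat \<Rightarrow> ('q, 's) config" where
  "computation M x 0 = ([], init M, Hash ## (x @- sconst Blank))"
| "computation M x (Suc m) = step M (computation M x m)"

lemma configuration_step:
  assumes "turing_machine M" and "configuration M c"
  shows "configuration M (step M c)"
proof -
  obtain v q v' where c: "c = (v, q, v')" by (cases c)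
  obtain s w where v': "v' = s ## w" by (cases v')
  obtain q' s' d where p: "prog M q s = (q', s', d)" by (cases "prog M q s")
  from assms(2) obtain N where q: "q \<in> states M"
    and al: "set v \<subseteq> alphabet M" "s \<in> alphabet M" "sset w \<subseteq> alphabet M"
    and N: "\<And>i. i \<ge> N \<Longrightarrow> (v @- s ## w) !! i = Blank"
    and H: "\<And>i. (v @- s ## w) !! i = Hash \<longleftrightarrow> i = 0"
    by (auto simp: configuration_def c v')
  have pr: "q' \<in> states M" "s' \<in> alphabet M" "s = Hash \<longleftrightarrow> s' = Hash" "s = Hash \<Longrightarrow> d \<noteq> MoveL"
    using assms(1) q al(2) p unfolding turing_machine_def by blast+
  have at: "(v @- s' ## w) !! i = (if i = length v then s' else (v @- s ## w) !! i)" for i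
    by (cases "i < length v"; cases "i - length v") (auto simp: not_less)
  have N': "\<exists>N. \<forall>i\<ge>N. (v @- s' ## w) !! i = Blank"
  proof (intro exI allI impI)
    fix i assume "max N (Suc (length v)) \<le> i"
    then show "(v @- s' ## w) !! i = Blank"
      unfolding at using N[of i] by simp
  qed
  have Hv: "s = Hash \<longleftrightarrow> v = []"
    using H[of "length v"] by simp
  have H': "(v @- s' ## w) !! i = Hash \<longleftrightarrow> i = 0" for i
    using H[of i] Hv pr(3) unfolding at by auto
  show ?thesis
  proof (cases d)
    case MoveL
    then have "v \<noteq> []" using pr(4) Hv by auto
    then obtain u b where v: "v = u @ [b]" by (metis append_butlast_last_id)
    show ?thesis
      using MoveL pr al N' H' by (auto simp: configuration_def c v' step_def p v)
  next
    case MoveS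
    then show ?thesis
      using pr al N' H' by (auto simp: configuration_def c v' step_def p)
  next
    case MoveR
    then show ?thesis
      using pr al N' H' by (auto simp: configuration_def c v' step_def p)
  qed
qed

lemma configuration_computation:
  assumes "turing_machine M" and "set x \<subseteq> alphabet M - {Blank, Hash}"
  shows "configuration M (computation M x m)"
proof (induction m)
  case 0
  have "(Hash ## (x @- sconst Blank)) !! i = Blank" if "i \<ge> Suc (length x)" for i
    using that by (cases i) auto
  moreover have "(Hash ## (x @- sconst Blank)) !! i = Hash \<longleftrightarrow> i = 0" for i
  proof (cases i)
    case (Suc j)
    show ?thesis
    proof (cases "j < length x")
      case True
      then have "x ! j \<noteq> Hash" using assms(2) nth_mem by fastforce
      then show ?thesis using Suc True by simp
    qed (simp add: Suc)
  qed simp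
  ultimately show ?case
    using assms by (auto simp: configuration_def turing_machine_def)
next
  case (Suc m)
  then show ?case using configuration_step[OF assms(1)] by simp
qed

text \<open>Halting configurations are repeated forever, so reaching \<open>q\<close> once suffices.\<close>

definition halts_in :: "('q, 's) tm \<Rightarrow> 's sym list \<Rightarrow> 'q \<Rightarrow> bool" where
  "halts_in M x q \<longleftrightarrow> q \<in> halting M \<and> (\<exists>k. config_state (computation M x k) = q)"

definition halts :: "('q, 's) tm \<Rightarrow> 's sym list \<Rightarrow> bool" where
  "halts M x \<longleftrightarrow> (\<exists>q. halts_in M x q)"

definition numeral_word :: "nat \<Rightarrow> 's sym list" where
  "numeral_word m = replicate m Bar"

section \<open>Computability of sets of natural numbers\<close>

text \<open>
  Since a machine has finitely many states and symbols, nothing is lost by taking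
  natural numbers for both.
\<close>

definition recursively_enumerable :: "nat set \<Rightarrow> bool" where
  "recursively_enumerable A \<longleftrightarrow>
     (\<exists>M :: (nat, nat) tm. turing_machine M \<and> Bar \<in> alphabet M \<and>
        (\<forall>m. m \<in> A \<longleftrightarrow> halts M (numeral_word m)))"

definition recursive_set :: "nat set \<Rightarrow> bool" where
  "recursive_set A \<longleftrightarrow>
     (\<exists>(M :: (nat, nat) tm) qyes qno. turing_machine M \<and> Bar \<in> alphabet M \<and> qyes \<noteq> qno \<and>
        (\<forall>m. (m \<in> A \<longrightarrow> halts_in M (numeral_word m) qyes) \<and>
             (m \<notin> A \<longrightarrow> halts_in M (numeral_word m) qno)))"

definition recursively_inseparable :: "nat set \<Rightarrow> nat set \<Rightarrow> bool" where
  "recursively_inseparable A B \<longleftrightarrow> \<not> (\<exists>R. recursive_set R \<and> A \<subseteq> R \<and> R \<inter> B = {})"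

section \<open>Tiles and tilings\<close>

record 'a tile =
  tleft :: "'a list"
  tright :: "'a list"
  tup :: "'a list"
  tdown :: "'a list"

abbreviation mk_tile :: "'a list \<Rightarrow> 'a list \<Rightarrow> 'a list \<Rightarrow> 'a list \<Rightarrow> 'a tile" where
  "mk_tile l r u d \<equiv> \<lparr>tleft = l, tright = r, tup = u, tdown = d\<rparr>"

definition tiling :: "'a tile set \<Rightarrow> (nat \<times> nat \<Rightarrow> 'a tile) \<Rightarrow> bool" where
  "tiling T f \<longleftrightarrow> range f \<subseteq> T \<and>
     (\<forall>i j. tright (f (i, j)) = tleft (f (Suc i, j)) \<and>
            tup (f (i, j)) = tdown (f (i, Suc j)))"

text \<open>The letters of tile words: tape symbols, states, and the two new symbols.\<close>

datatype ('q, 's) letter = Sym "'s sym" | St 'q | Otimes | Star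

definition config_word :: "('q, 's) config \<Rightarrow> ('q, 's) letter stream" where
  "config_word = (\<lambda>(v, q, v'). map Sym v @- (St q ## smap Sym v'))"

definition bars :: "nat \<Rightarrow> ('q, 's) letter list" where
  "bars k = map Sym (numeral_word k)"

definition tile0 :: "('q, 's) tm \<Rightarrow> ('q, 's) letter tile" where
  "tile0 M = mk_tile [Otimes] (bars 0) [St (init M), Sym Hash] [Otimes]"

definition copy_tiles :: "('q, 's) tm \<Rightarrow> ('q, 's) letter tile set" where
  "copy_tiles M =
     {mk_tile [Star] [Star] [Sym s] [Sym s] | s. s \<in> alphabet M - {Hash}} \<union>
     {mk_tile [Otimes] [Star] [Sym Hash] [Sym Hash]}"

definition stay_tiles :: "('q, 's) tm \<Rightarrow> ('q, 's) letter tile set" where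
  "stay_tiles M =
     {mk_tile [Star] [Star] [St q', Sym s'] [St q, Sym s] | q s q' s'.
        q \<in> states M \<and> s \<in> alphabet M \<and> s \<noteq> Hash \<and> prog M q s = (q', s', MoveS)} \<union>
     {mk_tile [Otimes] [Star] [St q', Sym Hash] [St q, Sym Hash] | q q' s'.
        q \<in> states M \<and> prog M q Hash = (q', s', MoveS)}"

definition right_tiles :: "('q, 's) tm \<Rightarrow> ('q, 's) letter tile set" where
  "right_tiles M =
     {mk_tile [Star] [St q, Sym s] [Sym s'] [St q, Sym s] | q s q' s'.
        q \<in> states M \<and> s \<in> alphabet M \<and> s \<noteq> Hash \<and> prog M q s = (q', s', MoveR)} \<union>
     {mk_tile [Otimes] [St q, Sym Hash] [Sym Hash] [St q, Sym Hash] | q q' s'.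
        q \<in> states M \<and> prog M q Hash = (q', s', MoveR)} \<union>
     {mk_tile [St q, Sym s] [Star] [St q', Sym a] [Sym a] | q s q' s' a.
        q \<in> states M \<and> s \<in> alphabet M \<and> prog M q s = (q', s', MoveR) \<and>
        a \<in> alphabet M - {Hash}}"

definition left_tiles :: "('q, 's) tm \<Rightarrow> ('q, 's) letter tile set" where
  "left_tiles M =
     {mk_tile [St q, Sym s] [Star] [Sym s'] [St q, Sym s] | q s q' s'.
        q \<in> states M \<and> s \<in> alphabet M \<and> prog M q s = (q', s', MoveL)} \<union>
     {mk_tile [Star] [St q, Sym s] [St q', Sym a] [Sym a] | q s q' s' a.
        q \<in> states M \<and> s \<in> alphabet M \<and> prog M q s = (q', s', MoveL) \<and>
        a \<in> alphabet M - {Hash}} \<union>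
     {mk_tile [Otimes] [St q, Sym s] [St q', Sym Hash] [Sym Hash] | q s q' s'.
        q \<in> states M \<and> s \<in> alphabet M \<and> prog M q s = (q', s', MoveL)}"

definition machine_tiles :: "('q, 's) tm \<Rightarrow> ('q, 's) letter tile set" where
  "machine_tiles M =
     {tile0 M} \<union> copy_tiles M \<union> stay_tiles M \<union> right_tiles M \<union> left_tiles M"

definition bar_tile :: "nat \<Rightarrow> ('q, 's) letter tile" where
  "bar_tile k = mk_tile (bars k) (bars (Suc k)) [Sym Bar] [Otimes]"

definition end_tile :: "nat \<Rightarrow> ('q, 's) letter tile" where
  "end_tile k = mk_tile (bars k) [Star, Star] [Sym Blank] [Otimes]"

definition blank_tile :: "('q, 's) letter tile" where
  "blank_tile = mk_tile [Star, Star] [Star, Star] [Sym Blank] [Otimes]"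

definition input_tiles :: "('q, 's) tm \<Rightarrow> nat \<Rightarrow> ('q, 's) letter tile set" where
  "input_tiles M n = machine_tiles M \<union> {bar_tile k | k. k < n} \<union> {end_tile n} \<union> {blank_tile}"

text \<open>
  The \<open>m\<close>-th row of a tiling, read off as the infinite concatenation of the upper words.
  The library function \<open>flat\<close> concatenates a stream of nonempty words, and the upper words
  of all tiles in \<open>input_tiles M n\<close> are nonempty.
\<close>

definition row_word :: "(nat \<times> nat \<Rightarrow> 'a tile) \<Rightarrow> nat \<Rightarrow> 'a stream" where
  "row_word f m = flat (smap (\<lambda>i. tup (f (i, m))) nats)"

lemma tup_input_tiles_nonempty: "t \<in> input_tiles M n \<Longrightarrow> tup t \<noteq> []"
  by (auto simp: input_tiles_def machine_tiles_def tile0_def copy_tiles_def stay_tiles_def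
      right_tiles_def left_tiles_def bar_tile_def end_tile_def blank_tile_def)

end

theory Submission
  imports Defs
begin

text \<open>
  The tiling is forced row by row, and the upper words of row \<open>m\<close> are the cells of the
  configuration \<open>C\<^sub>m\<close>, the state being written in front of the scanned symbol.

  The lowest row is forced from left to right: starting from \<open>tile0\<close>, the horizontal words
  count the bars in unary up to \<open>n\<close>, after which only blank tiles fit
  (\<open>bottom_row_unique\<close>).

  A higher row lies on the cells of a configuration, so it consists of tiles that simulate
  the program. Such a tile is determined by its left, right and lower words
  (\<open>step_tile_eqI\<close>), and only the horizontal words remain to be found. On the left border
  the word is \<open>Otimes\<close>, the only one that fits beside \<open>Hash\<close>. On every other edge it is
  \<open>Star\<close> or a pair \<open>q s\<close> that announces a head crossing the edge. The tiles
  are designed so that a pair for a move to the right must have the tile on the head at its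
  left end, and a pair for a move to the left must have it at its right end; conversely, if
  the program moves the head, the tile on the head forces the pair to be present. Hence a
  tile away from the head cannot guess that the head arrives: every edge
  carries exactly the word \<open>signal\<close> prescribed by the program
  (\<open>tright_eq_signal\<close>). The row with these edges exists and has the cells of the successor
  configuration as its upper words (\<open>step_row_in_step_tiles\<close>). Induction over the rows
  gives existence, uniqueness, and the description of the upper words.
\<close>

section \<open>Configurations as sequences of cells\<close>

definition tape :: "('q, 's) config \<Rightarrow> 's sym stream" where
  "tape c = fst c @- snd (snd c)"

definition head_position :: "('q, 's) config \<Rightarrow> nat" where
  "head_position c = length (fst c)"

definition scanned :: "('q, 's) config \<Rightarrow> 's sym" where
  "scanned c = tape c !! head_position c"

definition cell :: "('q, 's) config \<Rightarrow> nat \<Rightarrow> ('q, 's) letter list" where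
  "cell c i = (if i = head_position c then [St (config_state c), Sym (scanned c)]
               else [Sym (tape c !! i)])"

lemma config_state_conv: "config_state c = fst (snd c)"
  by (cases c) (simp add: config_state_def)

lemma scanned_conv: "scanned c = shd (snd (snd c))"
  by (simp add: scanned_def tape_def head_position_def)

lemma cell_eq_head_iff:
  "cell c i = [St r, Sym b] \<longleftrightarrow> i = head_position c \<and> r = config_state c \<and> b = scanned c"
  by (auto simp: cell_def)

lemma cell_neq_Otimes: "cell c i \<noteq> [Otimes]"
  by (simp add: cell_def)

lemma flat_map_singleton:
  "flat (map (\<lambda>a. [f a]) xs @- ws) = map f xs @- flat ws"
  by (induction xs) simp_all

lemma flat_smap_singleton: "flat (smap (\<lambda>a. [f a]) s) = smap f s"
  by (coinduction arbitrary: s) auto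

lemma config_word_eq_flat_cells: "config_word c = flat (smap (cell c) nats)"
proof -
  obtain v q v' where c: "c = (v, q, v')" by (cases c)
  have "smap (cell c) nats =
      map (\<lambda>a. [Sym a]) v @- [St q, Sym (shd v')] ## smap (\<lambda>a. [Sym a]) (stl v')"
    unfolding smap_alt
  proof
    fix i
    show "cell c (nats !! i) =
        (map (\<lambda>a. [Sym a]) v @- [St q, Sym (shd v')] ## smap (\<lambda>a. [Sym a]) (stl v')) !! i"
      by (cases "i < length v"; cases "i - length v")
        (auto simp: c cell_def tape_def head_position_def scanned_conv config_state_conv)
  qed
  then show ?thesis
    by (cases v') (simp add: c config_word_def flat_map_singleton flat_smap_singleton)
qed

lemma configuration_scanned:
  assumes "configuration M c"
  shows "config_state c \<in> states M" "tape c !! i \<in> alphabet M" "scanned c \<in> alphabet M"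
    "tape c !! i = Hash \<longleftrightarrow> i = 0" "scanned c = Hash \<longleftrightarrow> head_position c = 0"
proof -
  have "config_state c \<in> states M" and al: "sset (tape c) \<subseteq> alphabet M"
    and H: "\<And>i. tape c !! i = Hash \<longleftrightarrow> i = 0"
    using assms by (auto simp: configuration_def config_state_conv tape_def split_beta)
  then show "config_state c \<in> states M" "tape c !! i \<in> alphabet M" "scanned c \<in> alphabet M"
    "tape c !! i = Hash \<longleftrightarrow> i = 0" "scanned c = Hash \<longleftrightarrow> head_position c = 0"
    using snth_sset[of "tape c"] by (auto simp: scanned_def)
qed

lemma program_step:
  assumes "turing_machine M" "configuration M c"
    and "prog M (config_state c) (scanned c) = (q', s', d)"
  shows "s' \<in> alphabet M" "s' = Hash \<longleftrightarrow> head_position c = 0"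
    "d = MoveL \<Longrightarrow> head_position c \<noteq> 0"
proof -
  note c = configuration_scanned[OF assms(2)]
  show "s' \<in> alphabet M" "s' = Hash \<longleftrightarrow> head_position c = 0"
    "d = MoveL \<Longrightarrow> head_position c \<noteq> 0"
    using assms(1,3) c(1,3,5) unfolding turing_machine_def by blast+
qed

lemma step_components:
  assumes p: "prog M (config_state c) (scanned c) = (q', s', d)"
    and L: "d = MoveL \<Longrightarrow> head_position c \<noteq> 0"
  shows "config_state (step M c) = q'"
    and "tape (step M c) !! i = (if i = head_position c then s' else tape c !! i)"
    and "head_position (step M c) =
      (case d of MoveL \<Rightarrow> head_position c - 1 | MoveS \<Rightarrow> head_position c
        | MoveR \<Rightarrow> Suc (head_position c))"
proof -
  obtain v q v' where c: "c = (v, q, v')" by (cases c)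
  obtain s w where v': "v' = s ## w" by (cases v')
  have p': "prog M q s = (q', s', d)"
    using p by (simp add: c v' config_state_conv scanned_conv)
  show "config_state (step M c) = q'"
    by (cases d) (simp_all add: c v' config_state_conv step_def p')
  show "head_position (step M c) =
      (case d of MoveL \<Rightarrow> head_position c - 1 | MoveS \<Rightarrow> head_position c
        | MoveR \<Rightarrow> Suc (head_position c))"
    by (cases d) (simp_all add: c v' head_position_def step_def p')
  have "butlast v @- last v ## s' ## w = v @- s' ## w" if "v \<noteq> []"
    using that by (metis append_butlast_last_id shift.simps shift_append)
  then have "tape (step M c) = v @- s' ## w"
    using L by (cases d) (auto simp: c v' tape_def head_position_def step_def p')
  moreover have "(v @- s' ## w) !! i = (if i = length v then s' else (v @- s ## w) !! i)"
    by (cases "i < length v"; cases "i - length v") (auto simp: not_less)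
  ultimately show
    "tape (step M c) !! i = (if i = head_position c then s' else tape c !! i)"
    by (simp add: c v' tape_def head_position_def)
qed

section \<open>The tiles that simulate the program\<close>

definition step_tiles :: "('q, 's) tm \<Rightarrow> ('q, 's) letter tile set" where
  "step_tiles M = copy_tiles M \<union> stay_tiles M \<union> right_tiles M \<union> left_tiles M"

lemmas step_tiles_defs =
  step_tiles_def copy_tiles_def stay_tiles_def right_tiles_def left_tiles_def

lemma step_tiles_subset_input_tiles: "step_tiles M \<subseteq> input_tiles M n"
  by (auto simp: step_tiles_def input_tiles_def machine_tiles_def)

lemma input_tile_in_step_tiles:
  "t \<in> input_tiles M n \<Longrightarrow> tdown t \<noteq> [Otimes] \<Longrightarrow> t \<in> step_tiles M"
  by (auto simp: step_tiles_def input_tiles_def machine_tiles_def tile0_def bar_tile_def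
      end_tile_def blank_tile_def)

text \<open>
  The upper word is a function of the other three sides: on the head, the lower word selects
  a single program entry; off the head, a pair on the left edge announces a head moving
  right, one on the right edge a head moving left, and without a pair the symbol is copied.
\<close>

lemma step_tile_eqI:
  assumes "t \<in> step_tiles M" "t' \<in> step_tiles M"
    and "tleft t = tleft t'" "tright t = tright t'" "tdown t = tdown t'"
  shows "t = t'"
  using assms unfolding step_tiles_defs by auto

definition direction :: "('q, 's) tm \<Rightarrow> 'q \<Rightarrow> 's sym \<Rightarrow> move" where
  "direction M q s = snd (snd (prog M q s))"

lemma tright_step_tile_cases [consumes 1, case_names Star pair_right pair_left]:
  assumes "t \<in> step_tiles M"
  obtains (Star) "tright t = [Star]"
  | (pair_right) r b where "tright t = [St r, Sym b]" "direction M r b = MoveR"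
  | (pair_left) r b where "tright t = [St r, Sym b]" "direction M r b = MoveL"
  using assms unfolding step_tiles_defs by (auto simp: direction_def)

text \<open>
  The next two lemmas trace a pair on an edge to the tile on the head. If the program entry
  of the pair moves right, it comes from the tile on the left of the edge; if the entry moves
  left, from the tile on the right. The tile at the other end only receives the head.
\<close>

lemma tright_pair_iff_right_move:
  assumes "t \<in> step_tiles M" "direction M r b = MoveR"
  shows "tright t = [St r, Sym b] \<longleftrightarrow> tdown t = [St r, Sym b]"
  using assms unfolding step_tiles_defs by (auto simp: direction_def)

lemma tleft_pair_iff_left_move:
  assumes "t \<in> step_tiles M" "direction M r b = MoveL"
  shows "tleft t = [St r, Sym b] \<longleftrightarrow> tdown t = [St r, Sym b]"
  using assms unfolding step_tiles_defs by (auto simp: direction_def)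

text \<open>
  Moves to the left on \<open>Hash\<close> would give a tile with \<open>Hash\<close> below but a pair on the left
  edge; the restrictions on programs exclude them.
\<close>

lemma tleft_step_tile_Hash:
  assumes "turing_machine M" "t \<in> step_tiles M" "last (tdown t) = Sym Hash"
  shows "tleft t = [Otimes]"
proof -
  have "prog M q Hash \<noteq> (q', s', MoveL)" if "q \<in> states M" for q q' s'
    using assms(1) that unfolding turing_machine_def by blast
  then show ?thesis
    using assms(2,3) unfolding step_tiles_defs by auto
qed

section \<open>The row above a configuration\<close>

text \<open>The word on the edge between columns \<open>i\<close> and \<open>Suc i\<close> of the row above \<open>c\<close>.\<close>

definition signal :: "('q, 's) tm \<Rightarrow> ('q, 's) config \<Rightarrow> nat \<Rightarrow> ('q, 's) letter list" where
  "signal M c i =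
    (let q = config_state c; s = scanned c in
     if direction M q s = MoveR \<and> i = head_position c \<or>
        direction M q s = MoveL \<and> Suc i = head_position c
     then [St q, Sym s] else [Star])"

definition step_row :: "('q, 's) tm \<Rightarrow> ('q, 's) config \<Rightarrow> nat \<Rightarrow> ('q, 's) letter tile" where
  "step_row M c i =
    mk_tile (case i of 0 \<Rightarrow> [Otimes] | Suc j \<Rightarrow> signal M c j) (signal M c i)
      (cell (step M c) i) (cell c i)"

text \<open>
  There is no tile for a \<open>Hash\<close> that receives the head from its left or lies away from the
  border. None is missing, because \<open>Hash\<close> stands exactly in column 0, is preserved there,
  and the head never moves left from it.
\<close>

lemma step_row_in_step_tiles:
  assumes M: "turing_machine M" and conf: "configuration M c"
  shows "step_row M c i \<in> step_tiles M"
proof -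
  obtain q' s' d where p: "prog M (config_state c) (scanned c) = (q', s', d)"
    by (cases "prog M (config_state c) (scanned c)")
  note c = configuration_scanned[OF conf] and pr = program_step[OF M conf p]
  note st = step_components[OF p pr(3)]
  have tp: "tape c !! i = scanned c" if "i = head_position c"
    using that by (simp add: scanned_def)
  have d: "direction M (config_state c) (scanned c) = d"
    by (simp add: direction_def p)
  show ?thesis
  proof (cases d)
    case MoveS
    then show ?thesis
      using p c pr st d tp
      by (cases i) (auto simp: step_row_def signal_def cell_def scanned_def[of "step M c"]
          step_tiles_defs simp del: snth.simps)
  next
    case MoveR
    then show ?thesis
      using p c pr st d tp
      by (cases i) (auto simp: step_row_def signal_def cell_def scanned_def[of "step M c"]
          step_tiles_defs simp del: snth.simps)
  next
    case MoveL
    then obtain h where "head_position c = Suc h"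
      using pr(3) not0_implies_Suc by blast
    then show ?thesis
      using MoveL p c pr st d tp
      by (cases i) (auto simp: step_row_def signal_def cell_def scanned_def[of "step M c"]
          step_tiles_defs simp del: snth.simps)
  qed
qed

context
  fixes M :: "('q, 's) tm" and c :: "('q, 's) config"
    and g :: "nat \<Rightarrow> ('q, 's) letter tile"
  assumes tiles: "\<And>i. g i \<in> step_tiles M"
    and down: "\<And>i. tdown (g i) = cell c i"
    and edges: "\<And>i. tright (g i) = tleft (g (Suc i))"
begin

lemma tright_eq_signal: "tright (g i) = signal M c i"
using tiles[of i]
proof (cases rule: tright_step_tile_cases)
  case Star
  have "\<not> (direction M (config_state c) (scanned c) = MoveR \<and> i = head_position c)"
    using tright_pair_iff_right_move[OF tiles, of "config_state c" "scanned c" i] Star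
    by (auto simp: down cell_eq_head_iff)
  moreover
  have "\<not> (direction M (config_state c) (scanned c) = MoveL \<and> Suc i = head_position c)"
    using tleft_pair_iff_left_move[OF tiles, of "config_state c" "scanned c" "Suc i"] Star
    by (auto simp: down cell_eq_head_iff edges[symmetric])
  ultimately show ?thesis
    using Star by (auto simp: signal_def Let_def)
next
  case (pair_right r b)
  then have "cell c i = [St r, Sym b]"
    using tright_pair_iff_right_move[OF tiles] down by metis
  then show ?thesis
    using pair_right by (simp add: signal_def cell_eq_head_iff)
next
  case (pair_left r b)
  \<comment> \<open>A pair for a left move comes from the tile at its right end, here column \<open>Suc i\<close>.\<close>
  then have "cell c (Suc i) = [St r, Sym b]"
    using tleft_pair_iff_left_move[OF tiles] down edges by metis
  then show ?thesis
    using pair_left by (simp add: signal_def cell_eq_head_iff)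
qed

lemma row_eq_step_row:
  assumes "turing_machine M" "configuration M c"
  shows "g i = step_row M c i"
proof (rule step_tile_eqI[OF tiles step_row_in_step_tiles[OF assms]])
  show "tleft (g i) = tleft (step_row M c i)"
  proof (cases i)
    case 0
    have "last (cell c 0) = Sym Hash"
      using configuration_scanned(4)[OF assms(2), of 0] by (simp add: cell_def scanned_def)
    then show ?thesis
      using tleft_step_tile_Hash[OF assms(1) tiles] 0 by (simp add: down step_row_def)
  next
    case (Suc j)
    then show ?thesis
      using tright_eq_signal[of j] edges[of j] by (simp add: step_row_def)
  qed
qed (simp_all add: step_row_def tright_eq_signal down)

end

section \<open>The lowest row\<close>

definition bottom_row :: "('q, 's) tm \<Rightarrow> nat \<Rightarrow> nat \<Rightarrow> ('q, 's) letter tile" where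
  "bottom_row M n i =
    (case i of 0 \<Rightarrow> tile0 M
     | Suc k \<Rightarrow> if k < n then bar_tile k else if k = n then end_tile n else blank_tile)"

lemma bars_eq_iff [simp]: "bars k = bars l \<longleftrightarrow> k = l"
  by (metis bars_def length_map length_replicate numeral_word_def)

lemma bars_neq_Cons [simp]:
  assumes "x \<noteq> Sym Bar"
  shows "bars k \<noteq> x # xs" "x # xs \<noteq> bars k"
  using assms by (cases k; simp add: bars_def numeral_word_def)+

lemma tleft_step_tile_neq_bars:
  "t \<in> step_tiles M \<Longrightarrow> tleft t \<noteq> bars k \<and> tleft t \<noteq> [Star, Star]"
  unfolding step_tiles_defs by auto

lemma input_tiles_conv:
  "input_tiles M n =
    step_tiles M \<union> {tile0 M, end_tile n, blank_tile} \<union> {bar_tile k | k. k < n}"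
  by (auto simp: input_tiles_def machine_tiles_def step_tiles_def)

lemma bottom_row_in_input_tiles: "bottom_row M n i \<in> input_tiles M n"
  by (auto simp: bottom_row_def input_tiles_conv split: nat.split)

lemma bottom_row_edges: "tright (bottom_row M n i) = tleft (bottom_row M n (Suc i))"
  by (auto simp: bottom_row_def tile0_def bar_tile_def end_tile_def blank_tile_def
      split: nat.split)

lemma tup_bottom_row: "tup (bottom_row M n i) = cell (computation M (numeral_word n) 0) i"
  by (auto simp: bottom_row_def tile0_def bar_tile_def end_tile_def blank_tile_def cell_def
      head_position_def tape_def scanned_conv config_state_def numeral_word_def
      split: nat.split)

text \<open>
  The left words of the tiles for the input, \<open>bars k\<close> for \<open>k \<le> n\<close> and \<open>[Star, Star]\<close>, are
  distinct, and no other tile has one of them, since its left word is \<open>Star\<close> or \<open>Otimes\<close>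
  alone or begins with a state.
\<close>

lemma bottom_row_determined_by_tleft:
  assumes "t \<in> input_tiles M n" "tleft t = tleft (bottom_row M n (Suc i))"
  shows "t = bottom_row M n (Suc i)"
  using assms
  by (auto simp: bottom_row_def input_tiles_conv tile0_def bar_tile_def end_tile_def
      blank_tile_def split: if_splits dest: tleft_step_tile_neq_bars)

lemma bottom_row_unique:
  assumes "\<And>i. g i \<in> input_tiles M n" "\<And>i. tright (g i) = tleft (g (Suc i))"
    and "g 0 = tile0 M"
  shows "g i = bottom_row M n i"
proof (induction i)
  case 0
  then show ?case using assms(3) by (simp add: bottom_row_def)
next
  case (Suc i)
  then show ?case
    using assms(1,2) bottom_row_edges bottom_row_determined_by_tleft by metis
qed

section \<open>The tiling of the computation\<close>

fun computation_tiling ::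
  "('q, 's) tm \<Rightarrow> nat \<Rightarrow> nat \<times> nat \<Rightarrow> ('q, 's) letter tile" where
  "computation_tiling M n (i, 0) = bottom_row M n i"
| "computation_tiling M n (i, Suc m) = step_row M (computation M (numeral_word n) m) i"

lemma tup_computation_tiling:
  "tup (computation_tiling M n (i, m)) = cell (computation M (numeral_word n) m) i"
  by (cases m) (simp_all only: computation_tiling.simps tup_bottom_row step_row_def
      tile.simps computation.simps)

context
  fixes M :: "('q, 's) tm"
  assumes M: "turing_machine M" and Bar: "Bar \<in> alphabet M"
begin

lemma configuration_computation_numeral:
  "configuration M (computation M (numeral_word n) m)"
  by (rule configuration_computation[OF M]) (auto simp: numeral_word_def Bar)

lemma tiling_computation_tiling: "tiling (input_tiles M n) (computation_tiling M n)"
proof -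
  have "computation_tiling M n (i, m) \<in> input_tiles M n" for i m
    using bottom_row_in_input_tiles
      subsetD[OF step_tiles_subset_input_tiles
        step_row_in_step_tiles[OF M configuration_computation_numeral]]
    by (cases m) simp_all
  moreover have "tright (computation_tiling M n (i, m)) =
      tleft (computation_tiling M n (Suc i, m))" for i m
    by (cases m) (simp_all add: bottom_row_edges step_row_def)
  moreover have "tup (computation_tiling M n (i, m)) =
      tdown (computation_tiling M n (i, Suc m))" for i m
    by (simp add: tup_computation_tiling step_row_def)
  ultimately show ?thesis
    unfolding tiling_def by auto
qed

lemma tiling_eq_computation_tiling:
  assumes f: "tiling (input_tiles M n) f" and start: "f (0, 0) = tile0 M"
  shows "f = computation_tiling M n"
proof -
  have mem: "f (i, m) \<in> input_tiles M n"
    and right: "tright (f (i, m)) = tleft (f (Suc i, m))"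
    and up: "tup (f (i, m)) = tdown (f (i, Suc m))" for i m
    using f unfolding tiling_def by auto
  have "f (i, m) = computation_tiling M n (i, m)" for i m
  proof (induction m arbitrary: i)
    case 0
    show ?case
      using bottom_row_unique[of "\<lambda>i. f (i, 0)"] mem right start by simp
  next
    case (Suc m)
    let ?c = "computation M (numeral_word n) m"
    have down: "tdown (f (i, Suc m)) = cell ?c i" for i
      using up[of i m] Suc tup_computation_tiling[of M n i m] by simp
    have "f (i, Suc m) \<in> step_tiles M" for i
      using input_tile_in_step_tiles[OF mem] down cell_neq_Otimes by metis
    then have "f (i, Suc m) = step_row M ?c i"
      using row_eq_step_row[of "\<lambda>i. f (i, Suc m)" M ?c] down right M
        configuration_computation_numeral by blast
    then show ?case by simp
  qed
  then show ?thesis by auto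
qed

end

theorem proposition2p1:
  fixes X Y :: "nat set"
    and M0 :: "('q, 's) tm"
    and qX qY :: 'q
    and n :: nat
  assumes "X \<inter> Y = {}"
    and "recursively_enumerable X"
    and "recursively_enumerable Y"
    and "recursively_inseparable X Y"
    and "turing_machine M0"
    and "Bar \<in> alphabet M0"
    and "qX \<in> halting M0"
    and "qY \<in> halting M0"
    and "qX \<noteq> qY"
    and "\<And>m. m \<in> X \<Longrightarrow> halts_in M0 (numeral_word m) qX"
    and "\<And>m. m \<in> Y \<Longrightarrow> halts_in M0 (numeral_word m) qY"
    and "\<And>m. m \<notin> X \<union> Y \<Longrightarrow> \<not> halts M0 (numeral_word m)"
    and "\<And>m k. config_state (computation M0 (numeral_word m) k) \<in> halting M0 \<Longrightarrow>
           scans_leftmost (computation M0 (numeral_word m) k)"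
  shows "(\<exists>!f. tiling (input_tiles M0 n) f \<and> f (0, 0) = tile0 M0) \<and>
         (\<forall>f. tiling (input_tiles M0 n) f \<and> f (0, 0) = tile0 M0 \<longrightarrow>
            (\<forall>m. config_word (computation M0 (numeral_word n) m) = row_word f m))"
proof -
  note M0 = assms(5,6)
  have "computation_tiling M0 n (0, 0) = tile0 M0"
    by (simp add: bottom_row_def)
  moreover have "config_word (computation M0 (numeral_word n) m) =
      row_word (computation_tiling M0 n) m" for m
    by (simp add: row_word_def tup_computation_tiling config_word_eq_flat_cells)
  ultimately show ?thesis
    using tiling_computation_tiling[OF M0] tiling_eq_computation_tiling[OF M0] by metis
qed

end
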